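(* Let $G$ be a group, let $N\trianglelefteq G$ be a normal subgroup, let $a\in G$, and let $m\geq 0$ be an integer. Assume that $[N,a]\subseteq {\bf Z}_m(N)$, where ${\bf Z}_m(N)$ is the $m$-th center of $N$. Let $C={\bf C}_N(a^N)$. Then $N/C$ is nilpotent of class at most $m$.
   Context: The $m$-th centers of a group $N$ (terms of the upper central series) are defined by ${\bf Z}_0(N)=1$, ${\bf Z}_1(N)={\bf Z}(N)$ (the center of $N$), and ${\bf Z}_i(N)/{\bf Z}_{i-1}(N)={\bf Z}(N/{\bf Z}_{i-1}(N))$ for $i\ge 1$. Here $[N,a]=\{[n,a]\mid n\in N\}$ is the set of commutators of elements of $N$ with $a$ (where $[x,y]=x^{-1}y^{-1}xy$), $a^N=\{n^{-1}an\mid n\in N\}$, and ${\bf C}_N(a^N)=\{n\in N\mid n^{-1}xn=x\text{ for all }x\in a^N\}$, which is a normal subgroup of $N$. A group is nilpotent of class $0$ if and only if it is trivial. *)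

theory Defs
  imports "HOL-Algebra.Algebra"
begin

definition comm_elt :: "('a, 'b) monoid_scheme \<Rightarrow> 'a \<Rightarrow> 'a \<Rightarrow> 'a" where
  "comm_elt G x y = inv\<^bsub>G\<^esub> x \<otimes>\<^bsub>G\<^esub> inv\<^bsub>G\<^esub> y \<otimes>\<^bsub>G\<^esub> x \<otimes>\<^bsub>G\<^esub> y"

text \<open>The set \<open>[N, a]\<close> of commutators; not the subgroup they generate.\<close>

definition comm_set :: "('a, 'b) monoid_scheme \<Rightarrow> 'a set \<Rightarrow> 'a \<Rightarrow> 'a set" where
  "comm_set G N a = {comm_elt G n a | n. n \<in> N}"

text \<open>The conjugacy orbit \<open>a\<^sup>N\<close>; here \<open>a\<close> need not lie in \<open>N\<close>.\<close>

definition conj_orbit :: "('a, 'b) monoid_scheme \<Rightarrow> 'a set \<Rightarrow> 'a \<Rightarrow> 'a set" where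
  "conj_orbit G N a = {inv\<^bsub>G\<^esub> n \<otimes>\<^bsub>G\<^esub> a \<otimes>\<^bsub>G\<^esub> n | n. n \<in> N}"

definition centralizer_in :: "('a, 'b) monoid_scheme \<Rightarrow> 'a set \<Rightarrow> 'a set \<Rightarrow> 'a set" where
  "centralizer_in G N S = {n \<in> N. \<forall>x\<in>S. inv\<^bsub>G\<^esub> n \<otimes>\<^bsub>G\<^esub> x \<otimes>\<^bsub>G\<^esub> n = x}"

definition group_center :: "('a, 'b) monoid_scheme \<Rightarrow> 'a set" where
  "group_center G = {z \<in> carrier G. \<forall>g\<in>carrier G. z \<otimes>\<^bsub>G\<^esub> g = g \<otimes>\<^bsub>G\<^esub> z}"

text \<open>\<open>Z\<^sub>i\<^sub>+\<^sub>1(G)\<close> is the full preimage of \<open>Z(G/Z\<^sub>i(G))\<close> under the projection; see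
  \<open>upper_center_Suc_quotient\<close> below for the usual form of the recursion.\<close>

primrec upper_center :: "('a, 'b) monoid_scheme \<Rightarrow> nat \<Rightarrow> 'a set" where
  "upper_center G 0 = {\<one>\<^bsub>G\<^esub>}"
| "upper_center G (Suc i) =
     {x \<in> carrier G. upper_center G i #>\<^bsub>G\<^esub> x \<in> group_center (G Mod upper_center G i)}"

definition nilpotent_group :: "('a, 'b) monoid_scheme \<Rightarrow> bool" where
  "nilpotent_group G \<longleftrightarrow> group G \<and> (\<exists>c. upper_center G c = carrier G)"

text \<open>Only meaningful for nilpotent groups.\<close>

definition nilpotency_class :: "('a, 'b) monoid_scheme \<Rightarrow> nat" where
  "nilpotency_class G = (LEAST c. upper_center G c = carrier G)"

lemma (in group) upper_center_Suc_iff: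
  assumes "upper_center G i \<lhd> G"
  shows "x \<in> upper_center G (Suc i) \<longleftrightarrow> x \<in> carrier G \<and>
    (\<forall>y\<in>carrier G. upper_center G i #> (x \<otimes> y) = upper_center G i #> (y \<otimes> x))"
proof -
  interpret Z: normal "upper_center G i" G by fact
  show ?thesis
    by (auto simp: group_center_def FactGroup_def RCOSETS_def Z.rcos_sum)
qed

lemma (in group) upper_center_normal: "upper_center G i \<lhd> G"
proof (induction i)
  case 0
  show ?case by (simp add: one_is_normal)
next
  case (Suc i)
  let ?Z = "upper_center G i"
  interpret Z: normal ?Z G by fact
  interpret Q: group "G Mod ?Z" by (rule Z.factorgroup_is_group)
  interpret h: group_hom G "G Mod ?Z" "\<lambda>x. ?Z #> x"
    by unfold_locales (rule Z.r_coset_hom_Mod)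
  have mult: "?Z #> (x \<otimes> y) = (?Z #> x) \<otimes>\<^bsub>G Mod ?Z\<^esub> (?Z #> y)"
    if "x \<in> carrier G" "y \<in> carrier G" for x y
    using that by simp
  note iff = upper_center_Suc_iff[OF Suc.IH]
  have sub: "subgroup (upper_center G (Suc i)) G"
  proof (rule subgroupI)
    show "upper_center G (Suc i) \<subseteq> carrier G" by auto
    have "\<one> \<in> upper_center G (Suc i)" unfolding iff by simp
    then show "upper_center G (Suc i) \<noteq> {}" by blast
  next
    fix x assume x: "x \<in> upper_center G (Suc i)"
    then have xc: "x \<in> carrier G" by simp
    have "?Z #> (inv x \<otimes> y) = ?Z #> (y \<otimes> inv x)" if y: "y \<in> carrier G" for y
    proof -
      have "?Z #> (x \<otimes> (inv x \<otimes> y \<otimes> inv x)) = ?Z #> ((inv x \<otimes> y \<otimes> inv x) \<otimes> x)"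
        using x xc y unfolding iff by blast
      moreover have "x \<otimes> (inv x \<otimes> y \<otimes> inv x) = y \<otimes> inv x"
        using xc y by (simp add: m_assoc[symmetric])
      moreover have "(inv x \<otimes> y \<otimes> inv x) \<otimes> x = inv x \<otimes> y"
        using xc y by (simp add: m_assoc)
      ultimately show ?thesis by simp
    qed
    then show "inv x \<in> upper_center G (Suc i)" unfolding iff using xc by simp
  next
    fix x y assume x: "x \<in> upper_center G (Suc i)" and y: "y \<in> upper_center G (Suc i)"
    then have xc: "x \<in> carrier G" and yc: "y \<in> carrier G" by simp_all
    have "?Z #> (x \<otimes> y \<otimes> g) = ?Z #> (g \<otimes> (x \<otimes> y))" if g: "g \<in> carrier G" for g
    proof -
      have "?Z #> (x \<otimes> y \<otimes> g) = ?Z #> (x \<otimes> (y \<otimes> g))" using xc yc g by (simp add: m_assoc)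
      also have "\<dots> = ?Z #> ((y \<otimes> g) \<otimes> x)" using x yc g unfolding iff by blast
      also have "\<dots> = ?Z #> (y \<otimes> (g \<otimes> x))" using xc yc g by (simp add: m_assoc)
      also have "\<dots> = ?Z #> ((g \<otimes> x) \<otimes> y)" using y xc g unfolding iff by blast
      finally show ?thesis using xc yc g by (simp add: m_assoc)
    qed
    then show "x \<otimes> y \<in> upper_center G (Suc i)" unfolding iff using xc yc by blast
  qed
  show ?case
  proof (rule normal_invI[OF sub])
    fix g x assume x: "x \<in> upper_center G (Suc i)" and g: "g \<in> carrier G"
    then have xc: "x \<in> carrier G" by simp
    have "?Z #> (g \<otimes> x \<otimes> inv g) = (?Z #> (g \<otimes> x)) \<otimes>\<^bsub>G Mod ?Z\<^esub> (?Z #> inv g)"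
      using xc g by (intro mult) auto
    also have "?Z #> (g \<otimes> x) = ?Z #> (x \<otimes> g)"
      using x g unfolding iff by auto
    also have "(?Z #> (x \<otimes> g)) \<otimes>\<^bsub>G Mod ?Z\<^esub> (?Z #> inv g) = ?Z #> (x \<otimes> g \<otimes> inv g)"
      using xc g by (intro mult[symmetric]) auto
    also have "x \<otimes> g \<otimes> inv g = x" using xc g by (simp add: m_assoc)
    finally show "g \<otimes> x \<otimes> inv g \<in> upper_center G (Suc i)"
      using x xc g by (simp del: h.hom_mult)
  qed
qed

lemma (in group) upper_center_Suc_quotient:
  "(\<lambda>x. upper_center G i #> x) ` upper_center G (Suc i) = group_center (G Mod upper_center G i)"
  by (force simp: group_center_def FactGroup_def RCOSETS_def)

lemma (in group) upper_center_one: "upper_center G (Suc 0) = group_center G"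
proof -
  have "x \<in> upper_center G (Suc 0) \<longleftrightarrow> x \<in> group_center G" for x
    unfolding upper_center_Suc_iff[OF upper_center_normal] group_center_def
    by (auto simp: r_coset_def)
  then show ?thesis by blast
qed

text \<open>The quotient by \<open>C\<^sub>N(a\<^sup>N)\<close> makes sense.\<close>

lemma (in group) centralizer_conj_orbit_normal:
  assumes N: "subgroup N G" and a: "a \<in> carrier G"
  shows "centralizer_in G N (conj_orbit G N a) \<lhd> (G\<lparr>carrier := N\<rparr>)"
proof -
  let ?C = "centralizer_in G N (conj_orbit G N a)"
  interpret N: subgroup N G by fact
  interpret H: group "G\<lparr>carrier := N\<rparr>" by (rule subgroup.subgroup_is_group[OF N is_group])
  have orb: "x \<in> carrier G" if "x \<in> conj_orbit G N a" for x
    using that a by (auto simp: conj_orbit_def)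
  have iff: "n \<in> ?C \<longleftrightarrow> n \<in> N \<and> (\<forall>x\<in>conj_orbit G N a. x \<otimes> n = n \<otimes> x)" for n
  proof -
    have "inv n \<otimes> x \<otimes> n = x \<longleftrightarrow> x \<otimes> n = n \<otimes> x"
      if "n \<in> N" "x \<in> conj_orbit G N a" for x
      using that orb[of x] N.mem_carrier[of n]
      by (metis inv_solve_left m_assoc inv_closed m_closed)
    then show ?thesis unfolding centralizer_in_def by blast
  qed
  have invN: "inv\<^bsub>G\<lparr>carrier := N\<rparr>\<^esub> n = inv n" if "n \<in> N" for n
    using that m_inv_consistent[OF N] by simp
  have sub: "subgroup ?C (G\<lparr>carrier := N\<rparr>)"
  proof (rule H.subgroupI)
    show "?C \<subseteq> carrier (G\<lparr>carrier := N\<rparr>)" by (auto simp: centralizer_in_def)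
    have "\<one> \<in> ?C" unfolding iff using orb by simp
    then show "?C \<noteq> {}" by blast
  next
    fix n assume n: "n \<in> ?C"
    then have nN: "n \<in> N" unfolding iff by blast
    have "x \<otimes> inv n = inv n \<otimes> x" if x: "x \<in> conj_orbit G N a" for x
    proof -
      have "x \<otimes> n = n \<otimes> x" using n x unfolding iff by blast
      then show ?thesis using orb[OF x] N.mem_carrier[OF nN]
        by (metis inv_solve_left inv_solve_right m_assoc inv_closed m_closed)
    qed
    then show "inv\<^bsub>G\<lparr>carrier := N\<rparr>\<^esub> n \<in> ?C" unfolding invN[OF nN] unfolding iff
      using nN by blast
  next
    fix n k assume n: "n \<in> ?C" and k: "k \<in> ?C"
    then have nk: "n \<in> N" "k \<in> N" unfolding iff by blast+
    have "x \<otimes> (n \<otimes> k) = (n \<otimes> k) \<otimes> x" if x: "x \<in> conj_orbit G N a" for x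
    proof -
      have "x \<otimes> n = n \<otimes> x" "x \<otimes> k = k \<otimes> x" using n k x unfolding iff by blast+
      then show ?thesis using orb[OF x] nk[THEN N.mem_carrier] by (metis m_assoc)
    qed
    then show "n \<otimes>\<^bsub>G\<lparr>carrier := N\<rparr>\<^esub> k \<in> ?C" unfolding iff using nk by simp
  qed
  show ?thesis
  proof (rule H.normal_invI[OF sub])
    fix g n assume g': "g \<in> carrier (G\<lparr>carrier := N\<rparr>)" and n: "n \<in> ?C"
    then have g: "g \<in> N" and nN: "n \<in> N" unfolding iff by auto
    note gc = N.mem_carrier[OF g] and nc = N.mem_carrier[OF nN]
    have "x \<otimes> (g \<otimes> n \<otimes> inv g) = (g \<otimes> n \<otimes> inv g) \<otimes> x" if x: "x \<in> conj_orbit G N a" for x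
    proof -
      note xc = orb[OF x]
      obtain h where h: "h \<in> N" "x = inv h \<otimes> a \<otimes> h" using x by (auto simp: conj_orbit_def)
      define y where "y = inv g \<otimes> x \<otimes> g"
      have "y = inv (h \<otimes> g) \<otimes> a \<otimes> (h \<otimes> g)"
        unfolding y_def h(2) using gc N.mem_carrier[OF h(1)] a
        by (simp add: m_assoc inv_mult_group)
      then have "y \<in> conj_orbit G N a" using h(1) g by (auto simp: conj_orbit_def)
      then have yn: "y \<otimes> n = n \<otimes> y" using n unfolding iff by blast
      have yc: "y \<in> carrier G" unfolding y_def using gc xc by simp
      have xy: "x = g \<otimes> y \<otimes> inv g"
        unfolding y_def using gc xc by (simp add: m_assoc) (simp add: m_assoc[symmetric])
      have cancel: "inv g \<otimes> (g \<otimes> z) = z" if "z \<in> carrier G" for z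
        using that gc by (simp add: m_assoc[symmetric])
      have "x \<otimes> (g \<otimes> n \<otimes> inv g) = g \<otimes> (y \<otimes> n) \<otimes> inv g"
        unfolding xy using gc nc yc by (simp add: m_assoc cancel)
      also have "\<dots> = g \<otimes> (n \<otimes> y) \<otimes> inv g" by (simp only: yn)
      also have "\<dots> = (g \<otimes> n \<otimes> inv g) \<otimes> x"
        unfolding xy using gc nc yc by (simp add: m_assoc cancel)
      finally show ?thesis .
    qed
    then have "g \<otimes> n \<otimes> inv g \<in> ?C" unfolding iff using g nN by simp
    then show "g \<otimes>\<^bsub>G\<lparr>carrier := N\<rparr>\<^esub> n \<otimes>\<^bsub>G\<lparr>carrier := N\<rparr>\<^esub> inv\<^bsub>G\<lparr>carrier := N\<rparr>\<^esub> g \<in> ?C"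
      unfolding invN[OF g] by simp
  qed
qed

end

theory Submission
  imports Defs
begin

text \<open>Let \<open>Y\<^sub>k\<close> consist of the \<open>z \<in> G\<close> with \<open>[z, N] \<subseteq> Z\<^sub>k(N)\<close>; the hypothesis puts \<open>a\<^sup>N\<close> into
  \<open>Y\<^sub>m\<close>, and \<open>Z\<^sub>k\<^sub>+\<^sub>1(N) \<subseteq> Y\<^sub>k\<close>. Let \<open>K\<^sub>w\<close> consist of the \<open>x \<in> N\<close> with \<open>[z, x] \<in> Z\<^sub>k\<^sub>-\<^sub>w(N)\<close> for all \<open>k\<close>
  and all \<open>z \<in> Y\<^sub>k\<close>. Then \<open>K\<^sub>0 = N\<close> and \<open>K\<^sub>m\<close> centralizes \<open>a\<^sup>N\<close>. Modulo \<open>Z\<^sub>k\<^sub>-\<^sub>w\<^sub>-\<^sub>1(N)\<close>, conjugation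
  of \<open>z \<in> Y\<^sub>k\<close> by \<open>xy\<close> and by \<open>yx\<close> agree for \<open>x \<in> K\<^sub>w\<close> and \<open>y \<in> N\<close>, so commutators of \<open>K\<^sub>w\<close> with \<open>N\<close>
  lie in \<open>K\<^sub>w\<^sub>+\<^sub>1\<close>. Descending from \<open>w = m\<close> to \<open>w = 0\<close>, the image of \<open>K\<^sub>w\<close> in \<open>N/C\<close> lies in
  \<open>Z\<^sub>m\<^sub>-\<^sub>w(N/C)\<close>.\<close>

context group
begin

lemma inv_cancel_left:
  assumes "x \<in> carrier G" "y \<in> carrier G"
  shows "inv x \<otimes> (x \<otimes> y) = y" "x \<otimes> (inv x \<otimes> y) = y"
  using assms by (simp_all add: m_assoc[symmetric])

lemma comm_elt_closed [simp]:
  "x \<in> carrier G \<Longrightarrow> y \<in> carrier G \<Longrightarrow> comm_elt G x y \<in> carrier G"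
  by (simp add: comm_elt_def)

lemma comm_elt_one_left [simp]: "y \<in> carrier G \<Longrightarrow> comm_elt G \<one> y = \<one>"
  by (simp add: comm_elt_def)

lemma comm_elt_swap:
  assumes "x \<in> carrier G" "y \<in> carrier G"
  shows "comm_elt G y x = inv (comm_elt G x y)"
  using assms by (simp add: comm_elt_def inv_mult_group m_assoc)

lemma comm_elt_inv_inv:
  assumes "x \<in> carrier G" "y \<in> carrier G"
  shows "comm_elt G (inv x) (inv y) = x \<otimes> y \<otimes> inv x \<otimes> inv y"
  using assms by (simp add: comm_elt_def)

lemma comm_elt_subgroup:
  assumes "subgroup N G" "x \<in> N" "y \<in> N"
  shows "comm_elt (G\<lparr>carrier := N\<rparr>) x y = comm_elt G x y"
  using assms by (simp add: comm_elt_def m_inv_consistent)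

text \<open>The familiar [z, xy] = [z, y] [z, x]^y, with the conjugate s^y rewritten as s
  [s, y].\<close>

lemma comm_elt_mult_right:
  assumes "x \<in> carrier G" "y \<in> carrier G" "z \<in> carrier G"
  shows "comm_elt G z (x \<otimes> y) =
    comm_elt G z y \<otimes> comm_elt G z x \<otimes> comm_elt G (comm_elt G z x) y"
proof -
  define s where "s = comm_elt G z x"
  have s: "s \<in> carrier G" using assms by (simp add: s_def)
  have "comm_elt G z (x \<otimes> y) = inv z \<otimes> inv y \<otimes> z \<otimes> s \<otimes> y"
    using assms by (simp add: s_def comm_elt_def inv_mult_group m_assoc inv_cancel_left)
  also have "\<dots> = comm_elt G z y \<otimes> s \<otimes> comm_elt G s y"
    using assms s by (simp add: comm_elt_def m_assoc inv_cancel_left)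
  finally show ?thesis by (simp add: s_def)
qed

text \<open>Used with u = xy and v = yx: up to conjugation by v, only the discrepancy between [z, u]
  and [z, v] matters.\<close>

lemma comm_elt_mult_inv_right:
  assumes "u \<in> carrier G" "v \<in> carrier G" "z \<in> carrier G"
  shows "comm_elt G z (u \<otimes> inv v) = v \<otimes> (inv (comm_elt G z v) \<otimes> comm_elt G z u) \<otimes> inv v"
  using assms by (simp add: comm_elt_def inv_mult_group m_assoc inv_cancel_left)

text \<open>With \<open>t = [z, y]\<close> and \<open>s = [z, x]\<close>, the inner product is \<open>[z, yx]\<^sup>-\<^sup>1 [z, xy]\<close>.\<close>

lemma comm_elt_comm_elt:
  assumes "x \<in> carrier G" "y \<in> carrier G" "z \<in> carrier G"
  defines "s \<equiv> comm_elt G z x" and "t \<equiv> comm_elt G z y"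
  shows "comm_elt G z (comm_elt G (inv x) (inv y)) =
    (y \<otimes> x) \<otimes> (inv (comm_elt G t x) \<otimes> comm_elt G t s \<otimes> comm_elt G s y) \<otimes> inv (y \<otimes> x)"
proof -
  define p q where "p = comm_elt G t x" and "q = comm_elt G s y"
  have c: "s \<in> carrier G" "t \<in> carrier G" "p \<in> carrier G" "q \<in> carrier G"
    using assms(1-3) by (simp_all add: s_def t_def p_def q_def)
  have "comm_elt G (inv x) (inv y) = (x \<otimes> y) \<otimes> inv (y \<otimes> x)"
    using assms(1-3) by (simp add: comm_elt_inv_inv inv_mult_group m_assoc)
  moreover have "inv (comm_elt G z (y \<otimes> x)) \<otimes> comm_elt G z (x \<otimes> y) =
      inv (s \<otimes> t \<otimes> p) \<otimes> (t \<otimes> s \<otimes> q)"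
    using assms(1-3) by (simp add: comm_elt_mult_right s_def t_def p_def q_def)
  moreover have "\<dots> = inv p \<otimes> comm_elt G t s \<otimes> q"
    using c by (simp add: comm_elt_def inv_mult_group m_assoc)
  ultimately show ?thesis
    using assms(1-3) by (simp add: comm_elt_mult_inv_right p_def q_def)
qed

text \<open>Right cosets of xy and yx agree iff the normal subgroup contains xy (yx)^-1, which is
  [x^-1, y^-1]; hence the inverses.\<close>

lemma upper_center_Suc_iff_comm:
  "x \<in> upper_center G (Suc i) \<longleftrightarrow>
    x \<in> carrier G \<and> (\<forall>y\<in>carrier G. comm_elt G (inv x) (inv y) \<in> upper_center G i)"
proof -
  interpret Z: normal "upper_center G i" G by (rule upper_center_normal)
  have "upper_center G i #> (x \<otimes> y) = upper_center G i #> (y \<otimes> x) \<longleftrightarrow>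
      comm_elt G (inv x) (inv y) \<in> upper_center G i"
    if "x \<in> carrier G" "y \<in> carrier G" for y
  proof -
    have "comm_elt G (inv x) (inv y) = (x \<otimes> y) \<otimes> inv (y \<otimes> x)"
      using that by (simp add: comm_elt_inv_inv inv_mult_group m_assoc)
    moreover have "upper_center G i #> u = upper_center G i #> v \<longleftrightarrow> u \<otimes> inv v \<in> upper_center G i"
      if "u \<in> carrier G" "v \<in> carrier G" for u v
      unfolding Z.rcos_module[OF is_group that(2,1), symmetric]
      using repr_independence[OF _ that(2) Z.subgroup_axioms]
        rcos_self[OF that(1) Z.subgroup_axioms] by blast
    ultimately show ?thesis using that by simp
  qed
  then show ?thesis unfolding upper_center_Suc_iff[OF upper_center_normal] by blast
qed

lemma comm_elt_upper_center:
  assumes x: "x \<in> upper_center G i" and y: "y \<in> carrier G"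
  shows "comm_elt G x y \<in> upper_center G (i - 1)"
proof (cases i)
  case 0
  then show ?thesis using assms by simp
next
  case (Suc j)
  interpret Z: normal "upper_center G i" G by (rule upper_center_normal)
  \<comment> \<open>The criterion speaks of inverses, so it is applied to \<open>inv x\<close> and
    \<open>inv y\<close>.\<close>
  have "comm_elt G (inv (inv x)) (inv (inv y)) \<in> upper_center G j"
    using Z.m_inv_closed[OF x] y unfolding Suc upper_center_Suc_iff_comm by blast
  then show ?thesis using Z.mem_carrier[OF x] y unfolding Suc by (simp del: upper_center.simps)
qed

text \<open>Here \<open>z\<close> ranges over all of \<open>G\<close>, because \<open>a\<close> may
  lie outside \<open>N\<close>. For a subgroup \<open>N\<close>, the elements inside
  \<open>N\<close> form the center of \<open>N\<close> of index \<open>k + 1\<close>.\<close>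

definition rel_center :: "'a set \<Rightarrow> nat \<Rightarrow> 'a set" where
  "rel_center N k =
    {z \<in> carrier G. \<forall>n\<in>N. comm_elt G z n \<in> upper_center (G\<lparr>carrier := N\<rparr>) k}"

text \<open>The difference \<open>k - w\<close> is truncated, so \<open>x\<close> centralizes \<open>rel_center N k\<close> for \<open>k \<le> w\<close>.\<close>

definition lowering_set :: "'a set \<Rightarrow> nat \<Rightarrow> 'a set" where
  "lowering_set N w = {x \<in> N. \<forall>k. \<forall>z\<in>rel_center N k.
    comm_elt G z x \<in> upper_center (G\<lparr>carrier := N\<rparr>) (k - w)}"

lemma lowering_set_0: "lowering_set N 0 = N"
  by (auto simp: lowering_set_def rel_center_def)

lemma conj_orbit_subset_rel_center:
  assumes N: "subgroup N G" and a: "a \<in> carrier G"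
    and comm: "comm_set G N a \<subseteq> upper_center (G\<lparr>carrier := N\<rparr>) m"
  shows "conj_orbit G N a \<subseteq> rel_center N m"
proof
  interpret N: subgroup N G by fact
  interpret H: group "G\<lparr>carrier := N\<rparr>" by (rule N.subgroup_is_group[OF is_group])
  interpret Z: normal "upper_center (G\<lparr>carrier := N\<rparr>) m" "G\<lparr>carrier := N\<rparr>"
    by (rule H.upper_center_normal)
  fix z assume "z \<in> conj_orbit G N a"
  then obtain n where n: "n \<in> N" and z: "z = inv n \<otimes> a \<otimes> n" by (auto simp: conj_orbit_def)
  have "comm_elt G z y \<in> upper_center (G\<lparr>carrier := N\<rparr>) m" if y: "y \<in> N" for y
  proof -
    have c: "comm_elt G n a \<in> upper_center (G\<lparr>carrier := N\<rparr>) m"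
      "comm_elt G (n \<otimes> y) a \<in> upper_center (G\<lparr>carrier := N\<rparr>) m"
      using comm n y by (auto simp: comm_set_def)
    \<comment> \<open>The hypothesis only concerns commutators with \<open>a\<close> itself; this
      identity expresses [a^n, y] by two of them.\<close>
    have "comm_elt G z y = comm_elt G n a \<otimes> inv (comm_elt G (n \<otimes> y) a)"
      using n y a unfolding z comm_elt_def
      by (simp add: inv_mult_group m_assoc inv_cancel_left)
    moreover have "inv (comm_elt G (n \<otimes> y) a) \<in> upper_center (G\<lparr>carrier := N\<rparr>) m"
      using Z.m_inv_closed[OF c(2)] Z.mem_carrier[OF c(2)] m_inv_consistent[OF N] by simp
    ultimately show ?thesis using Z.m_closed[OF c(1)] by simp
  qed
  then show "z \<in> rel_center N m" using n a by (simp add: rel_center_def z)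
qed

text \<open>By \<open>comm_elt_comm_elt\<close>, it suffices that [t, x], [t, s] and [s, y] lie in
  the center of index \<open>k - Suc w\<close>, which is normal in \<open>N\<close>.\<close>

lemma lowering_set_Suc:
  assumes N: "subgroup N G" and x: "x \<in> lowering_set N w" and y: "y \<in> N"
  shows "comm_elt G (inv x) (inv y) \<in> lowering_set N (Suc w)"
proof -
  interpret N: subgroup N G by fact
  let ?H = "G\<lparr>carrier := N\<rparr>"
  interpret H: group ?H by (rule N.subgroup_is_group[OF is_group])
  have xN: "x \<in> N" using x by (simp add: lowering_set_def)
  have Z_sub: "u \<in> N" if "u \<in> upper_center ?H k" for u k
    using normal_imp_subgroup[OF H.upper_center_normal] that subgroup.mem_carrier by fastforce
  have Z_comm: "comm_elt G u v \<in> upper_center ?H (k - 1)"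
    if "u \<in> upper_center ?H k" "v \<in> N" for u v k
    using H.comm_elt_upper_center[OF that(1), of v]
      comm_elt_subgroup[OF N Z_sub[OF that(1)] that(2)] that(2)
    by (simp del: One_nat_def)
  have "comm_elt G z (comm_elt G (inv x) (inv y)) \<in> upper_center ?H (k - Suc w)"
    if z: "z \<in> rel_center N k" for k z
  proof -
    let ?Q = "upper_center ?H (k - Suc w)"
    interpret Q: normal ?Q ?H by (rule H.upper_center_normal)
    have Q_inv: "inv u \<in> ?Q" if "u \<in> ?Q" for u
      using Q.m_inv_closed[OF that] Z_sub[OF that] m_inv_consistent[OF N] by simp
    have Q_mult: "u \<otimes> v \<in> ?Q" if "u \<in> ?Q" "v \<in> ?Q" for u v
      using Q.m_closed[OF that] by simp
    have Q_conj: "g \<otimes> u \<otimes> inv g \<in> ?Q" if "u \<in> ?Q" "g \<in> N" for u g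
      using Q.inv_op_closed2[of g u] that m_inv_consistent[OF N] by simp
    define s t where "s = comm_elt G z x" and "t = comm_elt G z y"
    have zc: "z \<in> carrier G" using z by (simp add: rel_center_def)
    have s: "s \<in> upper_center ?H (k - w)"
      using x z unfolding s_def lowering_set_def by blast
    have t: "t \<in> upper_center ?H k"
      using y z unfolding t_def rel_center_def by blast
    have sy: "comm_elt G s y \<in> ?Q" using Z_comm[OF s y] by simp
    \<comment> \<open>Only \<open>t\<close> in \<open>N\<close> matters here: the drop in index
      comes from \<open>s\<close>.\<close>
    have "comm_elt G s t \<in> ?Q" using Z_comm[OF s Z_sub[OF t]] by simp
    then have ts: "comm_elt G t s \<in> ?Q"
      using Q_inv comm_elt_swap[of s t] N.mem_carrier Z_sub[OF s] Z_sub[OF t] by simp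
    have tx: "comm_elt G t x \<in> ?Q"
    \<comment> \<open>Here \<open>t\<close> supplies one step of the drop and \<open>x\<close> the
      other \<open>w\<close>. For \<open>k = 0\<close>, \<open>t\<close> is trivial.\<close>
    proof (cases k)
      case 0
      then show ?thesis using t xN by simp
    next
      case (Suc j)
      have "t \<in> rel_center N j"
        using Z_comm[OF t] Z_sub[OF t] Suc by (simp add: rel_center_def)
      then have "comm_elt G t x \<in> upper_center ?H (j - w)"
        using x unfolding lowering_set_def by blast
      then show ?thesis using Suc by simp
    qed
    show ?thesis
      unfolding comm_elt_comm_elt[OF N.mem_carrier[OF xN] N.mem_carrier[OF y] zc]
        s_def[symmetric] t_def[symmetric]
      by (intro Q_conj Q_mult Q_inv tx ts sy N.m_closed y xN)
  qed
  moreover have "comm_elt G (inv x) (inv y) \<in> N"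
    using xN y by (simp add: comm_elt_def)
  ultimately show ?thesis by (simp add: lowering_set_def)
qed

text \<open>At index \<open>m - m = 0\<close> the commutator [z, x] is trivial, and z^x = z
  [z, x].\<close>

lemma lowering_set_subset_centralizer:
  assumes N: "subgroup N G" and S: "S \<subseteq> rel_center N m"
  shows "lowering_set N m \<subseteq> centralizer_in G N S"
proof
  fix x assume x: "x \<in> lowering_set N m"
  then have xN: "x \<in> N" by (simp add: lowering_set_def)
  then have xc: "x \<in> carrier G" using subgroup.mem_carrier[OF N] by blast
  have "inv x \<otimes> z \<otimes> x = z" if "z \<in> S" for z
  proof -
    have z: "z \<in> rel_center N m" using S that by blast
    then have zc: "z \<in> carrier G" by (simp add: rel_center_def)
    have "comm_elt G z x \<in> upper_center (G\<lparr>carrier := N\<rparr>) (m - m)"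
      using x z unfolding lowering_set_def by blast
    then have "z \<otimes> comm_elt G z x = z" using zc by simp
    moreover have "z \<otimes> comm_elt G z x = inv x \<otimes> z \<otimes> x"
      using xc zc by (simp add: comm_elt_def m_assoc inv_cancel_left)
    ultimately show ?thesis by simp
  qed
  then show "x \<in> centralizer_in G N S" using xN by (simp add: centralizer_in_def)
qed

end

lemma (in group_hom) hom_comm_elt:
  assumes "x \<in> carrier G" "y \<in> carrier G"
  shows "h (comm_elt G x y) = comm_elt H (h x) (h y)"
  using assms by (simp add: comm_elt_def)

theorem theorem4p2:
  fixes G :: "('a, 'b) monoid_scheme" and N :: "'a set" and a :: 'a and m :: nat
  assumes "group G"
    and "N \<lhd> G"
    and "a \<in> carrier G"
    and "comm_set G N a \<subseteq> upper_center (G\<lparr>carrier := N\<rparr>) m"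
  shows "nilpotent_group ((G\<lparr>carrier := N\<rparr>) Mod (centralizer_in G N (conj_orbit G N a)))
    \<and> nilpotency_class ((G\<lparr>carrier := N\<rparr>) Mod (centralizer_in G N (conj_orbit G N a))) \<le> m"
proof -
  interpret group G by fact
  have N: "subgroup N G" using assms(2) by (rule normal_imp_subgroup)
  let ?H = "G\<lparr>carrier := N\<rparr>" and ?C = "centralizer_in G N (conj_orbit G N a)"
  let ?Q = "?H Mod ?C"
  interpret H: group ?H by (rule subgroup.subgroup_is_group[OF N is_group])
  interpret C: normal ?C ?H by (rule centralizer_conj_orbit_normal[OF N assms(3)])
  interpret Q: group ?Q by (rule C.factorgroup_is_group)
  interpret h: group_hom ?H ?Q "\<lambda>x. ?C #>\<^bsub>?H\<^esub> x"
    by unfold_locales (rule C.r_coset_hom_Mod)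
  have carrier_Q: "carrier ?Q = (\<lambda>x. ?C #>\<^bsub>?H\<^esub> x) ` N"
    by (auto simp: FactGroup_def RCOSETS_def)
  \<comment> \<open>The induction runs on \<open>i = m - w\<close>, starting from the members of
    \<open>?C\<close>, whose coset is the identity.\<close>
  have image: "?C #>\<^bsub>?H\<^esub> x \<in> upper_center ?Q i"
    if "i \<le> m" "x \<in> lowering_set N (m - i)" for i x
    using that
  proof (induction i arbitrary: x)
    case 0
    then have "x \<in> ?C"
      using lowering_set_subset_centralizer[OF N conj_orbit_subset_rel_center[OF N assms(3,4)]]
      by auto
    then show ?case using C.rcos_const[OF H.is_group] by (simp add: FactGroup_def)
  next
    case (Suc i)
    have x: "x \<in> N" using Suc.prems by (simp add: lowering_set_def)
    have "comm_elt ?Q (inv\<^bsub>?Q\<^esub> (?C #>\<^bsub>?H\<^esub> x)) (inv\<^bsub>?Q\<^esub> (?C #>\<^bsub>?H\<^esub> y)) \<in> upper_center ?Q i"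
      if y: "y \<in> N" for y
    proof -
      have "comm_elt G (inv\<^bsub>G\<^esub> x) (inv\<^bsub>G\<^esub> y) \<in> lowering_set N (Suc (m - Suc i))"
        using lowering_set_Suc[OF N Suc.prems(2) y] .
      \<comment> \<open>Truncated subtraction makes the bound \<open>Suc i \<le> m\<close>
        essential.\<close>
      also have "Suc (m - Suc i) = m - i" using Suc.prems by simp
      also have "comm_elt G (inv\<^bsub>G\<^esub> x) (inv\<^bsub>G\<^esub> y) = comm_elt ?H (inv\<^bsub>?H\<^esub> x) (inv\<^bsub>?H\<^esub> y)"
        using x y N by (simp add: comm_elt_subgroup m_inv_consistent subgroup.m_inv_closed)
      finally have "?C #>\<^bsub>?H\<^esub> comm_elt ?H (inv\<^bsub>?H\<^esub> x) (inv\<^bsub>?H\<^esub> y) \<in> upper_center ?Q i"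
        using Suc.IH Suc.prems(1) by simp
      moreover have "inv\<^bsub>?H\<^esub> x \<in> carrier ?H" "inv\<^bsub>?H\<^esub> y \<in> carrier ?H"
        using x y by (auto intro: H.inv_closed[simplified])
      ultimately show ?thesis
        using h.hom_comm_elt h.hom_inv x y by simp
    qed
    then show ?case
      unfolding Q.upper_center_Suc_iff_comm carrier_Q using x by blast
  qed
  \<comment> \<open>For \<open>i = m\<close> the lowering set is \<open>lowering_set N 0\<close>,
    all of \<open>N\<close>.\<close>
  have "carrier ?Q \<subseteq> upper_center ?Q m"
    using image[of m] by (auto simp: carrier_Q lowering_set_0)
  then have eq: "upper_center ?Q m = carrier ?Q"
    using subgroup.subset[OF normal_imp_subgroup[OF Q.upper_center_normal]] by blast
  have "nilpotent_group ?Q" unfolding nilpotent_group_def using Q.is_group eq by blast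
  moreover have "nilpotency_class ?Q \<le> m"
    unfolding nilpotency_class_def using eq by (rule Least_le)
  ultimately show ?thesis ..
qed

end
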